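(* Let $k\ge2$ be an integer and $n=2k$. Let $A$ be an $n\times n$ matrix with entries in $\{0,1\}$ such that every $k\times k$ minor of $A$ contains at least one entry equal to $1$. Then the number of entries of $A$ equal to $1$ is at least $3k+1$. Moreover, any two such matrices having exactly $3k+1$ entries equal to $1$ can be obtained from one another by permuting rows and columns.
   Context: A $k\times k$ minor of an $n\times n$ matrix means the $k\times k$ submatrix formed by the entries lying in some chosen $k$ rows and some chosen $k$ columns. *)

theory Defs
  imports "Jordan_Normal_Form.DL_Submatrix"
begin

(* Matrices are indexed from 0.  Here a minor is the submatrix itself, not its
   determinant, and the chosen rows and columns need not be contiguous. *)
definition square_minors :: "nat \<Rightarrow> 'a mat \<Rightarrow> 'a mat set" where
  "square_minors k A =
     {submatrix A I J | I J.
        I \<subseteq> {..<dim_row A} \<and> J \<subseteq> {..<dim_col A} \<and> card I = k \<and> card J = k}"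

definition ones_in_all_minors :: "nat \<Rightarrow> nat \<Rightarrow> int mat \<Rightarrow> bool" where
  "ones_in_all_minors k n A \<longleftrightarrow>
     A \<in> carrier_mat n n \<and> elements_mat A \<subseteq> {0, 1} \<and>
     (\<forall>M \<in> square_minors k A. 1 \<in> elements_mat M)"

definition num_ones :: "int mat \<Rightarrow> nat" where
  "num_ones A = card {(i, j). i < dim_row A \<and> j < dim_col A \<and> A $$ (i, j) = 1}"

definition permutation_equivalent :: "'a mat \<Rightarrow> 'a mat \<Rightarrow> bool" where
  "permutation_equivalent A B \<longleftrightarrow>
     (\<exists>p q. p permutes {..<dim_row A} \<and> q permutes {..<dim_col A} \<and>
        B = mat (dim_row A) (dim_col A) (\<lambda>(i, j). A $$ (p i, q j)))"

end

theory Submission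
  imports Defs
begin

text \<open>
  Read the ones of the matrix as the edges of a bipartite graph on two vertex classes of size
  \<open>2 * k\<close>. The hypothesis says that any \<open>k\<close> rows have at least \<open>k + 1\<close> neighbours. Applied to \<open>k\<close> rows
  of least degree, it gives degree sum at least \<open>k + 1\<close>; so one of them has degree at least 2, and
  therefore so does each of the other \<open>k\<close> rows, for a total of at least \<open>(k + 1) + 2 * k\<close>.

  In the case of equality no degree exceeds 2, and any \<open>k\<close> rows with degree sum \<open>k + 1\<close> have pairwise
  disjoint neighbourhoods. A row of degree 0 would force the rows of degree 2 to be pairwise disjoint,
  for which there are too few columns. So there are \<open>k - 1\<close> rows of degree 1, and likewise for
  columns; these form isolated edges. The rest is 2-regular on \<open>k + 1\<close> and \<open>k + 1\<close> vertices, and it is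
  a single cycle because a closed proper part, padded with isolated edges, would be a set of \<open>k\<close> rows
  with only \<open>k\<close> neighbours.
\<close>

section \<open>Least subsets and the size of neighbourhoods\<close>

lemma ex_least_subset:
  fixes f :: "'a \<Rightarrow> 'b::linorder"
  assumes "finite X" "m \<le> card X"
  shows "\<exists>S\<subseteq>X. card S = m \<and> (\<forall>s\<in>S. \<forall>t\<in>X - S. f s \<le> f t)"
  using assms(2)
proof (induction m)
  case 0
  show ?case by (intro exI[of _ "{}"]) auto
next
  case (Suc m)
  then obtain S where S: "S \<subseteq> X" "card S = m" "\<forall>s\<in>S. \<forall>t\<in>X - S. f s \<le> f t"
    by auto
  have fin: "finite S" using S(1) assms(1) finite_subset by blast
  have "X - S \<noteq> {}"
    using S Suc.prems fin by (metis Diff_eq_empty_iff card_mono not_less_eq_eq)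
  then obtain x where x: "x \<in> X - S" "\<forall>t\<in>X - S. f x \<le> f t"
    using assms(1) ex_min_if_finite[of "f ` (X - S)"] by (fastforce simp: not_less)
  show ?case
    using S x fin by (intro exI[of _ "insert x S"]) auto
qed

lemma card_Image_le_sum:
  fixes E :: "('a \<times> 'b) set"
  assumes "finite S"
  shows "card (E `` S) \<le> (\<Sum>x\<in>S. card (E `` {x}))"
  using card_UN_le[OF assms, of "\<lambda>x. E `` {x}"] by (simp add: Image_eq_UN[symmetric])

text \<open>The degree sum counts the common neighbour \<open>c\<close> twice: \<open>x\<close>
  already supplies it, so \<open>y\<close> adds at most its other neighbours to the image.\<close>

lemma card_Image_less_sum:
  fixes E :: "('a \<times> 'b) set"
  assumes "finite S" "finite E" "x \<in> S" "y \<in> S" "x \<noteq> y" "(x, c) \<in> E" "(y, c) \<in> E"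
  shows "card (E `` S) < (\<Sum>x\<in>S. card (E `` {x}))"
proof -
  have fin: "finite (E `` {y})" using assms(2) by (simp add: finite_Image)
  have "E `` S = E `` (S - {y}) \<union> (E `` {y} - {c})"
    using assms by auto
  then have "card (E `` S) \<le> card (E `` (S - {y})) + card (E `` {y} - {c})"
    by (metis card_Un_le)
  also have "\<dots> < card (E `` (S - {y})) + card (E `` {y})"
    using card_Diff1_less[OF fin, of c] assms(7) by simp
  also have "\<dots> \<le> (\<Sum>x\<in>S - {y}. card (E `` {x})) + card (E `` {y})"
    using card_Image_le_sum[of "S - {y}" E] assms(1) by simp
  also have "\<dots> = (\<Sum>x\<in>S. card (E `` {x}))"
    using assms(1,4) by (simp add: sum.remove)
  finally show ?thesis .
qed

section \<open>Bipartite form of the hypothesis and the lower bound\<close>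

locale hitting_relation =
  fixes k :: nat and X :: "'a set" and Y :: "'b set" and E :: "('a \<times> 'b) set"
  assumes finX: "finite X" and finY: "finite Y"
    and cardX: "card X = 2 * k" and cardY: "card Y = 2 * k"
    and E_sub: "E \<subseteq> X \<times> Y"
    and hit: "\<lbrakk>S \<subseteq> X; T \<subseteq> Y; card S = k; card T = k\<rbrakk> \<Longrightarrow> E \<inter> S \<times> T \<noteq> {}"
begin

abbreviation deg :: "'a \<Rightarrow> nat" where
  "deg x \<equiv> card (E `` {x})"

text \<open>Transposition: every fact about rows becomes available for columns.\<close>

lemma converse_hitting: "hitting_relation k Y X (E\<inverse>)"
proof
  show "E\<inverse> \<inter> S \<times> T \<noteq> {}" if "S \<subseteq> Y" "T \<subseteq> X" "card S = k" "card T = k" for S T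
    using hit[OF that(2,1,4,3)] by auto
qed (use finX finY cardX cardY E_sub in auto)

lemma finE: "finite E"
  using E_sub finX finY finite_subset by blast

text \<open>Otherwise at least \<open>k\<close> columns avoid all neighbours of \<open>S\<close>,
  and \<open>k\<close> of them together with \<open>S\<close> form a minor without ones.\<close>

lemma card_Image_ge:
  assumes "S \<subseteq> X" "card S = k"
  shows "card (E `` S) \<ge> k + 1"
proof (rule ccontr)
  assume "\<not> ?thesis"
  moreover have "E `` S \<subseteq> Y" using E_sub by auto
  ultimately have "k \<le> card (Y - E `` S)"
    using cardY finY by (simp add: card_Diff_subset finite_subset)
  then obtain T where "T \<subseteq> Y - E `` S" "card T = k"
    by (metis obtain_subset_with_card_n)
  with hit[OF assms(1) _ assms(2), of T] show False by auto
qed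

lemma sum_deg: "(\<Sum>x\<in>X. deg x) = card E"
proof -
  have "E = Sigma X (\<lambda>x. E `` {x})" using E_sub by auto
  then show ?thesis
    using card_SigmaI[of X "\<lambda>x. E `` {x}"] finX finE by (metis finite_Image)
qed

text \<open>The split into \<open>k\<close> rows of least degree and the rest serves both the lower
  bound and the analysis of equality. If all degrees in \<open>S\<close> were at most 1, their sum
  could not reach \<open>k + 1\<close>.\<close>

lemma degree_bounds:
  obtains S where "S \<subseteq> X" "card S = k" "card (X - S) = k" "k + 1 \<le> (\<Sum>x\<in>S. deg x)"
    "\<forall>t\<in>X - S. 2 \<le> deg t" "\<forall>s\<in>S. \<forall>t\<in>X - S. deg s \<le> deg t"
    "card E = (\<Sum>x\<in>S. deg x) + (\<Sum>x\<in>X - S. deg x)"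
proof -
  obtain S where S: "S \<subseteq> X" "card S = k" "\<forall>s\<in>S. \<forall>t\<in>X - S. deg s \<le> deg t"
    using ex_least_subset[of X k deg] finX cardX by auto
  have fin: "finite S" using S(1) finX finite_subset by blast
  have le: "k + 1 \<le> (\<Sum>x\<in>S. deg x)"
    using card_Image_ge[OF S(1,2)] card_Image_le_sum[OF fin, of E] by linarith
  have "\<exists>s\<in>S. 2 \<le> deg s"
  proof (rule ccontr)
    assume "\<not> ?thesis"
    then have "\<And>x. x \<in> S \<Longrightarrow> deg x \<le> 1" by force
    from sum_bounded_above[OF this] have "(\<Sum>x\<in>S. deg x) \<le> card S * 1" by simp
    with le S(2) show False by simp
  qed
  then have "\<forall>t\<in>X - S. 2 \<le> deg t" using S(3) le_trans by blast
  moreover have "card (X - S) = k" using S fin cardX by (simp add: card_Diff_subset)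
  moreover have "card E = (\<Sum>x\<in>S. deg x) + (\<Sum>x\<in>X - S. deg x)"
    using sum.subset_diff[OF S(1) finX, of deg] sum_deg by simp
  ultimately show thesis using that S le by blast
qed

lemma card_ge: "3 * k + 1 \<le> card E"
proof -
  obtain S where S: "S \<subseteq> X" "card S = k" "card (X - S) = k" "k + 1 \<le> (\<Sum>x\<in>S. deg x)"
    "\<forall>t\<in>X - S. 2 \<le> deg t" "\<forall>s\<in>S. \<forall>t\<in>X - S. deg s \<le> deg t"
    "card E = (\<Sum>x\<in>S. deg x) + (\<Sum>x\<in>X - S. deg x)"
    by (rule degree_bounds)
  have "card (X - S) * 2 \<le> (\<Sum>x\<in>X - S. deg x)"
    using sum_bounded_below[of "X - S" 2 deg] S(5) by auto
  with S show ?thesis by simp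
qed

end

section \<open>The case of equality: degrees and isolated edges\<close>

locale extremal_relation = hitting_relation +
  assumes card_E: "card E = 3 * k + 1"
begin

lemma converse_extremal: "extremal_relation k Y X (E\<inverse>)"
  using converse_hitting card_E
  by (simp add: extremal_relation_def extremal_relation_axioms_def)

text \<open>There is no slack: \<open>S\<close> takes at least \<open>k + 1\<close> edges, leaving
  at most \<open>2 * k\<close> for the \<open>k\<close> rows outside, each of degree at least 2.
  These have degree exactly 2 and bound the degrees in \<open>S\<close>.\<close>

lemma deg_le_2:
  assumes "x \<in> X"
  shows "deg x \<le> 2"
proof -
  obtain S where S: "S \<subseteq> X" "card S = k" "card (X - S) = k" "k + 1 \<le> (\<Sum>x\<in>S. deg x)"
    "\<forall>t\<in>X - S. 2 \<le> deg t" "\<forall>s\<in>S. \<forall>t\<in>X - S. deg s \<le> deg t"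
    "card E = (\<Sum>x\<in>S. deg x) + (\<Sum>x\<in>X - S. deg x)"
    by (rule degree_bounds)
  have eq: "(\<Sum>x\<in>X - S. deg x) \<le> (\<Sum>x\<in>X - S. 2)"
    using S card_E by simp
  have two: "deg t = 2" if "t \<in> X - S" for t
  proof (rule ccontr)
    assume "deg t \<noteq> 2"
    then have "(\<Sum>x\<in>X - S. 2) < (\<Sum>x\<in>X - S. deg x)"
      using that S(5) finX by (intro sum_strict_mono_ex1) force+
    with eq show False by simp
  qed
  \<comment> \<open>Positivity of \<open>k\<close> provides a row outside \<open>S\<close> to
    compare with; for \<open>k = 0\<close> the empty set would need a neighbour.\<close>
  have "k \<noteq> 0"
  proof
    assume "k = 0"
    then show False using card_Image_ge[of "{}"] by simp
  qed
  then have "X - S \<noteq> {}" using S(3) by fastforce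
  then show ?thesis using two S(6) assms by (metis DiffI ex_in_conv order_refl)
qed

text \<open>The names \<open>pendant\<close> and \<open>cyclic\<close> anticipate the structure:
  rows of degree 1 turn out to lie on isolated edges, rows of degree 2 on one cycle.\<close>

definition pendant :: "'a set" where
  "pendant = {x \<in> X. deg x = 1}"

definition cyclic :: "'a set" where
  "cyclic = {x \<in> X. deg x = 2}"

lemma finite_pendant: "finite pendant" and finite_cyclic: "finite cyclic"
  using finX by (auto simp: pendant_def cyclic_def)

text \<open>A shared neighbour would make the image smaller than the degree sum, hence of size at
  most \<open>k\<close>.\<close>

lemma neighbours_disjoint:
  assumes "S \<subseteq> X" "card S = k" "(\<Sum>x\<in>S. deg x) \<le> k + 1"
    "x \<in> S" "y \<in> S" "(x, c) \<in> E" "(y, c) \<in> E"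
  shows "x = y"
  using card_Image_less_sum[of S E x y c] card_Image_ge[of S] assms finE finite_subset[OF _ finX]
  by fastforce

lemma degree_classes:
  shows "X = pendant \<union> cyclic" and "card pendant = k - 1" and "card cyclic = k + 1"
    and k_pos: "k > 0"
proof -
  define Z where "Z = {x \<in> X. deg x = 0}"
  define U where "U = Z \<union> pendant"
  have finZ: "finite Z" using finX by (simp add: Z_def)
  have X: "X = U \<union> cyclic"
    using deg_le_2 by (auto simp: U_def Z_def pendant_def cyclic_def numeral_2_eq_2 le_Suc_eq)
  have disj: "Z \<inter> pendant = {}" "U \<inter> cyclic = {}"
    by (auto simp: U_def Z_def pendant_def cyclic_def)
  have finU: "finite U" using finZ finite_pendant by (simp add: U_def)
  have cU: "card U = card Z + card pendant"
    using disj finZ finite_pendant by (simp add: U_def card_Un_disjoint)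
  have sU: "(\<Sum>x\<in>U. deg x) = card pendant"
    using disj finZ finite_pendant by (simp add: U_def sum.union_disjoint) (simp add: Z_def pendant_def)
  have sT: "(\<Sum>x\<in>T. deg x) = 2 * card T" if "T \<subseteq> cyclic" for T
  proof -
    have "(\<Sum>x\<in>T. deg x) = (\<Sum>x\<in>T. 2)"
      using that by (intro sum.cong) (auto simp: cyclic_def)
    then show ?thesis by simp
  qed
  have 1: "card U + card cyclic = 2 * k"
    using X disj finU finite_cyclic cardX by (metis card_Un_disjoint)
  have 2: "card pendant + 2 * card cyclic = 3 * k + 1"
    using X disj finU finite_cyclic sum_deg card_E sU sT[of cyclic]
    by (metis order_refl sum.union_disjoint)
  \<comment> \<open>The two counts give \<open>card cyclic = k + 1 + card Z\<close> and
    \<open>card pendant + 2 * card Z = k - 1\<close>, so it remains to exclude rows of degree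
    0.\<close>
  have "card Z = 0"
  proof (rule ccontr)
    assume Z: "card Z \<noteq> 0"
    \<comment> \<open>Pairwise disjoint neighbourhoods would fill
      \<open>2 * card cyclic > 2 * k\<close> columns.\<close>
    have "\<exists>x\<in>cyclic. \<exists>y\<in>cyclic. x \<noteq> y \<and> E `` {x} \<inter> E `` {y} \<noteq> {}"
    proof (rule ccontr)
      assume "\<not> ?thesis"
      then have "card (\<Union>x\<in>cyclic. E `` {x}) = (\<Sum>x\<in>cyclic. deg x)"
        using finite_cyclic finE by (intro card_UN_disjoint) (auto simp: finite_Image)
      moreover have "card (\<Union>x\<in>cyclic. E `` {x}) \<le> card Y"
        using E_sub finY by (intro card_mono) auto
      ultimately show False using sT[of cyclic] 1 2 cU cardY by simp
    qed
    then obtain x y c where xy: "x \<in> cyclic" "y \<in> cyclic" "x \<noteq> y" "(x, c) \<in> E" "(y, c) \<in> E"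
      by auto
    \<comment> \<open>With this size, \<open>U \<union> T\<close> has \<open>k\<close> rows and
      degree sum \<open>k + 1\<close>. Since \<open>card Z\<close> is positive, there is room in
      \<open>T\<close> for both \<open>x\<close> and \<open>y\<close>.\<close>
    have "\<exists>T. {x, y} \<subseteq> T \<and> T \<subseteq> cyclic \<and> card T = card Z + 1"
      using xy Z 1 2 cU finite_cyclic by (intro exists_subset_between) auto
    then obtain T where T: "{x, y} \<subseteq> T" "T \<subseteq> cyclic" "card T = card Z + 1" by blast
    have fT: "finite T" "U \<inter> T = {}" using T finite_cyclic finite_subset disj by blast+
    have "card (U \<union> T) = k" using fT finU T cU 1 2 by (simp add: card_Un_disjoint)
    moreover have "(\<Sum>x\<in>U \<union> T. deg x) \<le> k + 1"
      using fT finU T sT[of T] sU cU 1 2 by (simp add: sum.union_disjoint)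
    moreover have "U \<union> T \<subseteq> X" using X T by blast
    ultimately show False using neighbours_disjoint[of "U \<union> T" x y c] xy T by blast
  qed
  then have "Z = {}" using finZ by simp
  then show "X = pendant \<union> cyclic" using X by (simp add: U_def)
  show "card pendant = k - 1" "card cyclic = k + 1" "k > 0"
    using 1 2 cU \<open>card Z = 0\<close> by auto
qed

text \<open>The \<open>k - 1\<close> pendant rows and any one cyclic row \<open>t\<close> have
  degree sum \<open>k + 1\<close>, so their neighbourhoods are disjoint. If \<open>y\<close> is
  cyclic, it is taken as \<open>t\<close>.\<close>

lemma pendant_isolated:
  assumes "x \<in> pendant" "y \<in> X" "(x, c) \<in> E" "(y, c) \<in> E"
  shows "x = y"
proof -
  obtain t where t: "t \<in> cyclic" "y \<in> insert t pendant"
  proof (cases "y \<in> cyclic")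
    case True
    with that show thesis by blast
  next
    case False
    have "cyclic \<noteq> {}" using degree_classes(3) by fastforce
    with False that assms(2) degree_classes(1) show thesis by blast
  qed
  have t': "t \<notin> pendant" using t by (auto simp: pendant_def cyclic_def)
  have "card (insert t pendant) = k"
    using t' finite_pendant degree_classes(2) k_pos by simp
  moreover have "(\<Sum>x\<in>pendant. deg x) = card pendant" by (simp add: pendant_def)
  then have "(\<Sum>x\<in>insert t pendant. deg x) \<le> k + 1"
    using t t' finite_pendant degree_classes(2) k_pos by (simp add: cyclic_def)
  moreover have "insert t pendant \<subseteq> X" using t by (auto simp: pendant_def cyclic_def)
  ultimately show ?thesis
    using neighbours_disjoint[of "insert t pendant" x y c] assms t by blast
qed

text \<open>Pad \<open>S\<close> with \<open>k - card S\<close> pendant rows, each adding at most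
  one neighbour; \<open>k - 1\<close> pendant rows suffice because \<open>S\<close> is nonempty.
  This later prevents a path from closing up too early.\<close>

lemma card_Image_cyclic:
  assumes "S \<subseteq> cyclic" "S \<noteq> {}" "card S \<le> k"
  shows "card S < card (E `` S)"
proof -
  have fin: "finite S" using assms(1) finite_cyclic finite_subset by blast
  then have "k - card S \<le> card pendant" using assms(2) degree_classes(2) card_gt_0_iff[of S] by linarith
  then obtain P where P: "P \<subseteq> pendant" "card P = k - card S"
    by (metis obtain_subset_with_card_n)
  have finP: "finite P" using P(1) finite_pendant finite_subset by blast
  have "S \<inter> P = {}" using P(1) assms(1) by (force simp: pendant_def cyclic_def)
  then have "card (S \<union> P) = k" using fin finP P(2) assms(3) by (simp add: card_Un_disjoint)
  moreover have "S \<union> P \<subseteq> X" using P(1) assms(1) by (auto simp: pendant_def cyclic_def)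
  ultimately have "k + 1 \<le> card (E `` (S \<union> P))" by (intro card_Image_ge)
  also have "\<dots> \<le> card (E `` S) + card (E `` P)" by (simp add: Image_Un card_Un_le)
  also have "card (E `` P) \<le> (\<Sum>x\<in>P. deg x)" using card_Image_le_sum finP by blast
  also have "(\<Sum>x\<in>P. deg x) = (\<Sum>x\<in>P. 1)"
    using P(1) by (intro sum.cong) (auto simp: pendant_def)
  finally show ?thesis using P(2) assms(3) by simp
qed

lemma pendant_neighbour:
  assumes "x \<in> pendant" "(x, c) \<in> E"
  shows "card (E\<inverse> `` {c}) = 1"
proof -
  have "E\<inverse> `` {c} = {x}" using pendant_isolated assms E_sub by blast
  then show ?thesis by simp
qed

section \<open>Both sides together: the matching and the single cycle\<close>

interpretation conv: extremal_relation k Y X "E\<inverse>"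
  by (rule converse_extremal)

text \<open>This separates the isolated edges from the 2-regular part. The backward direction is the
  forward argument applied to the transpose.\<close>

lemma pendant_iff:
  assumes "(x, c) \<in> E"
  shows "x \<in> pendant \<longleftrightarrow> c \<in> conv.pendant"
proof
  show "c \<in> conv.pendant" if "x \<in> pendant"
    using pendant_neighbour[OF that assms] assms E_sub unfolding conv.pendant_def by blast
  show "x \<in> pendant" if "c \<in> conv.pendant"
    using conv.pendant_neighbour[OF that, of x] assms E_sub unfolding pendant_def converse_converse by blast
qed

lemma cyclic_iff:
  assumes "(x, c) \<in> E"
  shows "x \<in> cyclic \<longleftrightarrow> c \<in> conv.cyclic"
proof -
  have "x \<in> X" "c \<in> Y" using assms E_sub by auto
  moreover have "pendant \<inter> cyclic = {}" "conv.pendant \<inter> conv.cyclic = {}"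
    by (force simp: pendant_def cyclic_def conv.pendant_def conv.cyclic_def)+
  ultimately show ?thesis
    using pendant_iff[OF assms] degree_classes(1) conv.degree_classes(1) by blast
qed

text \<open>Isolation gives injectivity; surjectivity follows because both pendant classes have
  \<open>k - 1\<close> elements.\<close>

lemma pendant_matching:
  obtains g where "bij_betw g pendant conv.pendant" "\<forall>x\<in>pendant. E `` {x} = {g x}"
proof -
  have "\<forall>x\<in>pendant. \<exists>c. E `` {x} = {c}"
    unfolding pendant_def by (metis (mono_tags, lifting) card_1_singletonE mem_Collect_eq)
  from bchoice[OF this] obtain g where g: "\<forall>x\<in>pendant. E `` {x} = {g x}" by blast
  then have E: "(x, g x) \<in> E" if "x \<in> pendant" for x
    using that by (metis Image_singleton_iff insertI1)
  have "inj_on g pendant"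
  proof (rule inj_onI)
    fix x y assume xy: "x \<in> pendant" "y \<in> pendant" "g x = g y"
    then have "y \<in> X" by (simp add: pendant_def)
    with xy show "x = y" using pendant_isolated[of x y "g x"] E by metis
  qed
  moreover have "g ` pendant \<subseteq> conv.pendant" using E pendant_iff by blast
  then have "g ` pendant = conv.pendant"
    using \<open>inj_on g pendant\<close> degree_classes(2) conv.degree_classes(2) conv.finite_pendant
    by (simp add: card_image card_subset_eq)
  ultimately show thesis using that g by (simp add: bij_betw_def)
qed

text \<open>The path alternates \<open>c 0, r 0, c 1, r 1, ..., c m\<close>. Its end has a second
  row \<open>x\<close>, which is new because earlier rows meet only earlier columns. The column
  \<open>y\<close> may be old, so the step serves both to extend the path and to close it.\<close>

lemma path_step:
  fixes r :: "nat \<Rightarrow> 'a" and c :: "nat \<Rightarrow> 'b"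
  assumes "inj_on c {..m}" "c m \<in> conv.cyclic" "\<forall>i<m. E `` {r i} = {c i, c (Suc i)}"
  obtains x y where "x \<in> cyclic" "x \<notin> r ` {..<m}" "y \<in> conv.cyclic" "y \<noteq> c m" "E `` {x} = {c m, y}"
proof -
  have "card (E\<inverse> `` {c m}) = 2" using assms(2) by (simp add: conv.cyclic_def)
  \<comment> \<open>For \<open>m = 0\<close> the row \<open>r (m - 1)\<close> is an arbitrary value
    \<open>r 0\<close>; the argument only uses that two neighbours do not fit into a
    singleton.\<close>
  then have "\<not> E\<inverse> `` {c m} \<subseteq> {r (m - 1)}"
    using card_mono[of "{r (m - 1)}" "E\<inverse> `` {c m}"] by auto
  then obtain x where x: "(x, c m) \<in> E" "x \<noteq> r (m - 1)" by blast
  have xc: "x \<in> cyclic" using cyclic_iff[OF x(1)] assms(2) by simp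
  have "x \<notin> r ` {..<m}"
  proof
    assume "x \<in> r ` {..<m}"
    then obtain i where i: "i < m" "x = r i" by auto
    with x(1) assms(3) have "c m = c i \<or> c m = c (Suc i)" by blast
    with i(1) assms(1) have "m = Suc i" by (auto dest: inj_onD)
    with i(2) x(2) show False by simp
  qed
  moreover obtain y where y: "E `` {x} = {c m, y}" "y \<noteq> c m"
  proof -
    have "card (E `` {x}) = 2" using xc by (simp add: cyclic_def)
    then obtain a b where "E `` {x} = {a, b}" "a \<noteq> b" by (auto simp: card_2_iff)
    moreover have "c m \<in> E `` {x}" using x(1) by simp
    ultimately show thesis using that by (metis doubleton_eq_iff empty_iff insert_iff)
  qed
  moreover have "y \<in> conv.cyclic" using cyclic_iff[of x y] y(1) xc by blast
  ultimately show thesis using that xc by blast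
qed

lemma ex_path:
  assumes "m \<le> k"
  shows "\<exists>r c. inj_on r {..<m} \<and> inj_on c {..m} \<and> r ` {..<m} \<subseteq> cyclic \<and>
    c ` {..m} \<subseteq> conv.cyclic \<and> (\<forall>i<m. E `` {r i} = {c i, c (Suc i)})"
  using assms
proof (induction m)
  case 0
  obtain c0 where "c0 \<in> conv.cyclic" using conv.degree_classes(3) by fastforce
  then show ?case by (intro exI[of _ undefined] exI[of _ "\<lambda>_. c0"]) auto
next
  case (Suc m)
  then obtain r c where rc: "inj_on r {..<m}" "inj_on c {..m}" "r ` {..<m} \<subseteq> cyclic"
    "c ` {..m} \<subseteq> conv.cyclic" "\<forall>i<m. E `` {r i} = {c i, c (Suc i)}"
    by (meson Suc_leD)
  have "c m \<in> conv.cyclic" using rc(4) by auto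
  then obtain x y where xy: "x \<in> cyclic" "x \<notin> r ` {..<m}" "y \<in> conv.cyclic" "y \<noteq> c m" "E `` {x} = {c m, y}"
    using path_step[OF rc(2) _ rc(5)] by blast
  let ?S = "insert x (r ` {..<m})"
  have S: "card ?S = Suc m" "?S \<subseteq> cyclic"
    using xy rc by (auto simp: card_image)
  \<comment> \<open>Otherwise the \<open>Suc m\<close> rows of \<open>?S\<close> would have all
    their neighbours among the \<open>Suc m\<close> columns of the path, against
    \<open>card_Image_cyclic\<close>, which applies since \<open>Suc m \<le> k\<close>.\<close>
  have "y \<notin> c ` {..m}"
  proof
    assume "y \<in> c ` {..m}"
    then have "E `` ?S \<subseteq> c ` {..m}" using rc(5) xy(5) by fastforce
    then have "card (E `` ?S) \<le> Suc m"
      using card_mono[of "c ` {..m}"] rc(2) by (fastforce simp: card_image)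
    with card_Image_cyclic[OF S(2)] S(1) Suc.prems show False by simp
  qed
  then have "inj_on (c(Suc m := y)) {..Suc m}"
    using rc(2) by (simp add: atMost_Suc inj_on_fun_updI)
  moreover have "inj_on (r(m := x)) {..<Suc m}"
    using rc(1) xy(2) by (simp add: lessThan_Suc inj_on_fun_updI)
  moreover have "\<forall>i<Suc m. E `` {(r(m := x)) i} = {(c(Suc m := y)) i, (c(Suc m := y)) (Suc i)}"
    using rc(5) xy(5) by (auto simp: less_Suc_eq)
  moreover have "(r(m := x)) ` {..<Suc m} \<subseteq> cyclic" "(c(Suc m := y)) ` {..Suc m} \<subseteq> conv.cyclic"
    using rc(3,4) xy(1,3) by (auto simp: less_Suc_eq le_Suc_eq)
  ultimately show ?case by blast
qed

text \<open>A path with \<open>k\<close> rows uses all \<open>k + 1\<close> cyclic columns and all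
  but one cyclic row, so one more step must return to a column of the path.\<close>

lemma ex_cycle:
  obtains r c where "bij_betw r {..k} cyclic" "bij_betw c {..k} conv.cyclic"
    "\<forall>i\<le>k. E `` {r i} = {c i, c (Suc i mod Suc k)}"
proof -
  obtain r c where rc: "inj_on r {..<k}" "inj_on c {..k}" "r ` {..<k} \<subseteq> cyclic"
    "c ` {..k} \<subseteq> conv.cyclic" "\<forall>i<k. E `` {r i} = {c i, c (Suc i)}"
    using ex_path[of k] by blast
  have "c k \<in> conv.cyclic" using rc(4) by auto
  then obtain x y where xy: "x \<in> cyclic" "x \<notin> r ` {..<k}" "y \<in> conv.cyclic" "y \<noteq> c k"
    "E `` {x} = {c k, y}"
    using path_step[OF rc(2) _ rc(5)] by blast
  have c: "c ` {..k} = conv.cyclic"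
    using rc(2,4) conv.degree_classes(3) conv.finite_cyclic by (simp add: card_image card_subset_eq)
  then obtain i where i: "i \<le> k" "y = c i" using xy(3) by auto
  \<comment> \<open>An inner column \<open>c (Suc j)\<close> already meets \<open>r j\<close> and
    \<open>r (Suc j)\<close>, so \<open>x\<close> would be a third neighbour. The end
    \<open>c k\<close> is excluded by \<open>y \<noteq> c k\<close>.\<close>
  have "i = 0"
  proof (rule ccontr)
    assume "i \<noteq> 0"
    with i xy(4) obtain j where j: "i = Suc j" "Suc j < k" by (metis le_neq_implies_less not0_implies_Suc)
    have "E `` {r j} = {c j, c (Suc j)}" "E `` {r (Suc j)} = {c (Suc j), c (Suc (Suc j))}"
      using rc(5) j(2) by simp_all
    then have "y \<in> E `` {r j}" "y \<in> E `` {r (Suc j)}" "y \<in> E `` {x}"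
      using xy(5) i(2) j(1) by simp_all
    then have "{r j, r (Suc j), x} \<subseteq> E\<inverse> `` {y}" by simp
    then have "card {r j, r (Suc j), x} \<le> card (E\<inverse> `` {y})"
      using finE by (intro card_mono) (auto simp: finite_Image)
    moreover have "r j \<noteq> r (Suc j)" using inj_on_eq_iff[OF rc(1), of j "Suc j"] j(2) by simp
    moreover have "r j \<noteq> x" "r (Suc j) \<noteq> x" using xy(2) j(2) by force+
    ultimately show False using xy(3) by (simp add: conv.cyclic_def)
  qed
  have inj: "inj_on (r(k := x)) {..k}"
    using rc(1) xy(2) by (simp add: lessThan_Suc_atMost[symmetric] lessThan_Suc inj_on_fun_updI)
  have "(r(k := x)) ` {..k} \<subseteq> cyclic" using rc(3) xy(1) by auto
  then have "(r(k := x)) ` {..k} = cyclic"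
    using card_image[OF inj] degree_classes(3) by (intro card_subset_eq[OF finite_cyclic]) simp_all
  with inj have "bij_betw (r(k := x)) {..k} cyclic" by (simp add: bij_betw_def)
  moreover have "bij_betw c {..k} conv.cyclic" using c rc(2) by (simp add: bij_betw_def)
  \<comment> \<open>At \<open>i = k\<close> the modulus wraps to index 0, matching
    \<open>y = c 0\<close>.\<close>
  moreover have "\<forall>i\<le>k. E `` {(r(k := x)) i} = {c i, c (Suc i mod Suc k)}"
    using rc(5) xy(5) i(2) \<open>i = 0\<close> by auto
  ultimately show thesis using that by blast
qed

text \<open>The pattern depends on \<open>k\<close> alone: the full diagonal together with a cyclic
  shift on the first \<open>k + 1\<close> indices. Hence any two extremal relations are
  isomorphic.\<close>

lemma normal_form:
  obtains r c where "bij_betw r {..<2 * k} X" "bij_betw c {..<2 * k} Y"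
    "\<forall>i<2 * k. \<forall>j<2 * k. (r i, c j) \<in> E \<longleftrightarrow> j = i \<or> (i \<le> k \<and> j = Suc i mod Suc k)"
proof -
  obtain r c where rc: "bij_betw r {..k} cyclic" "bij_betw c {..k} conv.cyclic"
    "\<forall>i\<le>k. E `` {r i} = {c i, c (Suc i mod Suc k)}"
    using ex_cycle by blast
  obtain g where g: "bij_betw g pendant conv.pendant" "\<forall>x\<in>pendant. E `` {x} = {g x}"
    using pendant_matching by blast
  have "card {Suc k..<2 * k} = card pendant" using degree_classes(2) by simp
  then obtain h where h: "bij_betw h {Suc k..<2 * k} pendant"
    using finite_same_card_bij finite_pendant by blast
  define r' where "r' i = (if i \<le> k then r i else h i)" for i
  \<comment> \<open>Numbering pendant columns through the matching \<open>g\<close> puts the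
    isolated edges on the diagonal.\<close>
  define c' where "c' i = (if i \<le> k then c i else g (h i))" for i
  have split: "{..<2 * k} = {..k} \<union> {Suc k..<2 * k}" using k_pos by auto
  have disj: "cyclic \<inter> pendant = {}" "conv.cyclic \<inter> conv.pendant = {}"
    by (force simp: pendant_def cyclic_def conv.pendant_def conv.cyclic_def)+
  have "bij_betw r' {..k} cyclic" "bij_betw r' {Suc k..<2 * k} pendant"
    using rc(1) h by (subst bij_betw_cong[of _ _ r] bij_betw_cong[of _ _ h]; simp add: r'_def)+
  then have r': "bij_betw r' {..<2 * k} X"
    using bij_betw_combine[of r' _ _ _ pendant] disj split degree_classes(1) by (metis Un_commute)
  have gh: "bij_betw (\<lambda>i. g (h i)) {Suc k..<2 * k} conv.pendant"
    using bij_betw_trans[OF h g(1)] by (simp add: comp_def)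
  have "bij_betw c' {..k} conv.cyclic" "bij_betw c' {Suc k..<2 * k} conv.pendant"
    using rc(2) gh
    by (subst bij_betw_cong[of _ _ c] bij_betw_cong[of _ _ "\<lambda>i. g (h i)"]; simp add: c'_def)+
  then have c': "bij_betw c' {..<2 * k} Y"
    using bij_betw_combine[of c' _ _ _ conv.pendant] disj split conv.degree_classes(1)
    by (metis Un_commute)
  \<comment> \<open>For \<open>i > k\<close> the pair collapses to \<open>{c' i}\<close>, so one
    formula covers cycle and matching.\<close>
  have E: "E `` {r' i} = {c' i, c' (if i \<le> k then Suc i mod Suc k else i)}" if "i < 2 * k" for i
  proof (cases "i \<le> k")
    case True
    moreover have "Suc i mod Suc k \<le> k" using less_Suc_eq_le by auto
    ultimately show ?thesis using rc(3) by (simp add: r'_def c'_def)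
  next
    case False
    then have "h i \<in> pendant" using that bij_betwE[OF h] by simp
    with False g(2) show ?thesis by (simp add: r'_def c'_def)
  qed
  have "(r' i, c' j) \<in> E \<longleftrightarrow> j = i \<or> (i \<le> k \<and> j = Suc i mod Suc k)"
    if "i < 2 * k" "j < 2 * k" for i j
  proof -
    have inj: "c' j = c' l \<longleftrightarrow> j = l" if "l < 2 * k" for l
      using c' that \<open>j < 2 * k\<close> by (auto simp: bij_betw_def dest: inj_onD)
    have "Suc i mod Suc k < 2 * k"
      using mod_less_divisor[of "Suc k" "Suc i"] k_pos by linarith
    then have "c' j = c' (if i \<le> k then Suc i mod Suc k else i) \<longleftrightarrow> j = (if i \<le> k then Suc i mod Suc k else i)"
      using inj that by simp
    moreover have "(r' i, c' j) \<in> E \<longleftrightarrow> c' j \<in> E `` {r' i}" by simp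
    ultimately show ?thesis using E[OF that(1)] inj[OF that(1)] by auto
  qed
  with r' c' that show thesis by blast
qed

end

section \<open>Translation between matrices and relations\<close>

definition ones :: "int mat \<Rightarrow> (nat \<times> nat) set" where
  "ones A = {(i, j). i < dim_row A \<and> j < dim_col A \<and> A $$ (i, j) = 1}"

lemma hitting_relation_ones:
  assumes "ones_in_all_minors k (2 * k) A"
  shows "hitting_relation k {..<2 * k} {..<2 * k} (ones A)"
proof
  have A: "dim_row A = 2 * k" "dim_col A = 2 * k"
    using assms by (auto simp: ones_in_all_minors_def)
  then show "ones A \<subseteq> {..<2 * k} \<times> {..<2 * k}" by (auto simp: ones_def)
  fix S T :: "nat set"
  assume ST: "S \<subseteq> {..<2 * k}" "T \<subseteq> {..<2 * k}" "card S = k" "card T = k"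
  then have "submatrix A S T \<in> square_minors k A"
    using A by (auto simp: square_minors_def)
  then have "1 \<in> elements_mat (submatrix A S T)"
    using assms by (auto simp: ones_in_all_minors_def)
  then obtain i j where ij: "i < dim_row (submatrix A S T)" "j < dim_col (submatrix A S T)"
    "submatrix A S T $$ (i, j) = 1"
    by (metis elements_matD)
  \<comment> \<open>The dimensions of a submatrix count only selected indices within range; here
    these are all of \<open>S\<close> and \<open>T\<close>, so \<open>pick\<close> stays inside
    them.\<close>
  have "{i. i < dim_row A \<and> i \<in> S} = S" "{j. j < dim_col A \<and> j \<in> T} = T"
    using ST A by auto
  with ij have "i < card S" "j < card T" "A $$ (pick S i, pick T j) = 1"
    by (auto simp: submatrix_def)
  moreover from this have "pick S i \<in> S" "pick T j \<in> T" by (auto intro: pick_in_set_le)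
  moreover from this have "pick S i < 2 * k" "pick T j < 2 * k" using ST by auto
  ultimately have "(pick S i, pick T j) \<in> ones A \<inter> S \<times> T"
    using A by (simp add: ones_def)
  then show "ones A \<inter> S \<times> T \<noteq> {}" by blast
qed auto

text \<open>Take \<open>f\<close> after the inverse of \<open>g\<close> on \<open>S\<close>, and the
  identity outside \<open>S\<close> as \<open>permutes\<close> demands. It turns two numberings of
  the same set into a permutation.\<close>

lemma ex_permutes_factor:
  assumes "bij_betw f A S" "bij_betw g A S"
  obtains p where "p permutes S" "\<forall>x\<in>A. p (g x) = f x"
proof
  let ?q = "f \<circ> inv_into A g"
  let ?p = "\<lambda>x. if x \<in> S then ?q x else x"
  have "bij_betw ?q S S"
    using bij_betw_trans[OF bij_betw_inv_into[OF assms(2)] assms(1)] .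
  then have "bij_betw ?p S S" by (auto cong: bij_betw_cong)
  then show "?p permutes S" by (rule bij_imp_permutes) simp
  show "\<forall>x\<in>A. ?p (g x) = f x"
    using assms(2) by (auto simp: bij_betw_inv_into_left dest: bij_betwE)
qed

theorem theorem4:
  fixes k n :: nat
  assumes "k \<ge> 2" and "n = 2 * k"
  shows "(\<forall>A. ones_in_all_minors k n A \<longrightarrow> num_ones A \<ge> 3 * k + 1) \<and>
         (\<forall>A B. ones_in_all_minors k n A \<and> ones_in_all_minors k n B \<and>
                num_ones A = 3 * k + 1 \<and> num_ones B = 3 * k + 1 \<longrightarrow>
                permutation_equivalent A B)"
proof (intro conjI allI impI)
  have num: "num_ones A = card (ones A)" for A
    by (simp add: num_ones_def ones_def)
  show "num_ones A \<ge> 3 * k + 1" if "ones_in_all_minors k n A" for A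
    using hitting_relation.card_ge[OF hitting_relation_ones] that assms(2) num by metis
  fix A B
  assume AB: "ones_in_all_minors k n A \<and> ones_in_all_minors k n B \<and>
    num_ones A = 3 * k + 1 \<and> num_ones B = 3 * k + 1"
  have ext: "extremal_relation k {..<2 * k} {..<2 * k} (ones A)"
    "extremal_relation k {..<2 * k} {..<2 * k} (ones B)"
    using AB hitting_relation_ones assms(2) num
    by (auto simp: extremal_relation_def extremal_relation_axioms_def)
  obtain r c where rc: "bij_betw r {..<2 * k} {..<2 * k}" "bij_betw c {..<2 * k} {..<2 * k}"
    "\<forall>i<2 * k. \<forall>j<2 * k. (r i, c j) \<in> ones A \<longleftrightarrow> j = i \<or> (i \<le> k \<and> j = Suc i mod Suc k)"
    using extremal_relation.normal_form[OF ext(1)] by metis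
  obtain r' c' where rc': "bij_betw r' {..<2 * k} {..<2 * k}" "bij_betw c' {..<2 * k} {..<2 * k}"
    "\<forall>i<2 * k. \<forall>j<2 * k. (r' i, c' j) \<in> ones B \<longleftrightarrow> j = i \<or> (i \<le> k \<and> j = Suc i mod Suc k)"
    using extremal_relation.normal_form[OF ext(2)] by metis
  \<comment> \<open>The permutations carry the numbering of \<open>B\<close> to that of
    \<open>A\<close>, because \<open>permutation_equivalent\<close> reads the entries of
    \<open>B\<close> off permuted positions of \<open>A\<close>.\<close>
  obtain p where p: "p permutes {..<2 * k}" "\<forall>i\<in>{..<2 * k}. p (r' i) = r i"
    using ex_permutes_factor[OF rc(1) rc'(1)] by blast
  obtain q where q: "q permutes {..<2 * k}" "\<forall>i\<in>{..<2 * k}. q (c' i) = c i"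
    using ex_permutes_factor[OF rc(2) rc'(2)] by blast
  have dim: "dim_row A = 2 * k" "dim_col A = 2 * k" "dim_row B = 2 * k" "dim_col B = 2 * k"
    and el: "elements_mat A \<subseteq> {0, 1}" "elements_mat B \<subseteq> {0, 1}"
    using AB assms(2) by (auto simp: ones_in_all_minors_def)
  \<comment> \<open>With entries 0 and 1 only, the positions of the ones determine the matrix, so
    comparing \<open>ones A\<close> and \<open>ones B\<close> is enough.\<close>
  have entry: "M $$ (i, j) = (if (i, j) \<in> ones M then 1 else 0)"
    if "elements_mat M \<subseteq> {0, 1}" "i < dim_row M" "j < dim_col M" for M i j
    using that elements_matI[of M "dim_row M" "dim_col M" i j] by (auto simp: ones_def)
  have "B $$ (i, j) = A $$ (p i, q j)" if ij: "i < 2 * k" "j < 2 * k" for i j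
  proof -
    have "i \<in> r' ` {..<2 * k}" "j \<in> c' ` {..<2 * k}"
      using rc'(1,2) ij by (simp_all add: bij_betw_def)
    then obtain a b where ab: "a < 2 * k" "i = r' a" "b < 2 * k" "j = c' b" by auto
    then have pq: "p i = r a" "q j = c b" using p(2) q(2) by auto
    have "(i, j) \<in> ones B \<longleftrightarrow> (p i, q j) \<in> ones A"
      using rc(3) rc'(3) ab pq by simp
    moreover have "p i < 2 * k" "q j < 2 * k"
      using permutes_in_image[OF p(1)] permutes_in_image[OF q(1)] ij by auto
    ultimately show ?thesis using entry el dim ij by simp
  qed
  then have "B = mat (dim_row A) (dim_col A) (\<lambda>(i, j). A $$ (p i, q j))"
    using dim by (intro eq_matI) auto
  then show "permutation_equivalent A B"
    using p(1) q(1) dim unfolding permutation_equivalent_def by auto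
qed

end
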